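(* Let $k$ be a positive integer with $k \equiv 1 \pmod 5$ and let \[ n = L_{CC}(10,k) = \frac{512k^5+1280k^4+6560k^3+9520k^2+6100k+1028}{3125}. \] Then there is an undirected Cayley graph of the cyclic group $\mathbb{Z}_n$ on five generators which has diameter $k$. Moreover, a generating set for such a graph is \[ \Big\{1,\ \tfrac{128k^4+448k^3+1688k^2+3768k+843}{625},\ \tfrac{256k^4+416k^3+2816k^2+2346k+416}{625},\ \tfrac{256k^4+576k^3+3136k^2+3976k+1431}{625},\ \tfrac{384k^4+864k^3+4504k^2+5614k+1134}{625}\Big\}, \] i.e. the Cayley graph of $\mathbb{Z}_n$ with connection set $\{\pm g_1,\dots,\pm g_5\}$, where $g_1,\dots,g_5$ are these integers taken modulo $n$, has diameter $k$.
   Context: For a positive integer $n$ and integers $g_1,\dots,g_5$, the undirected Cayley (circulant) graph of the cyclic group $\mathbb{Z}_n$ with generating set $\{g_1,\dots,g_5\}$ has vertex set $\mathbb{Z}_n$, with $i$ and $j$ adjacent if and only if $j-i \equiv \pm g_t \pmod n$ for some $t$. Its diameter is the maximum over pairs of vertices of the graph distance. The notation $L_{CC}(10,k)$ is just a name for the displayed polynomial value. *)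

theory Defs
  imports "Graph_Theory.Graph_Theory" "HOL-Number_Theory.Cong"
begin

text \<open>
  As usual in this library, an undirected graph is a symmetric digraph. The vertices of
  \<open>\<int>\<^sub>n\<close> are represented by the residues \<open>0, \<dots>, n - 1\<close>.
\<close>

definition circulant_graph :: "int \<Rightarrow> int set \<Rightarrow> (int, int \<times> int) pre_digraph" where
  "circulant_graph n S =
     \<lparr> verts = {0..<n},
       arcs = {(i, j). i \<in> {0..<n} \<and> j \<in> {0..<n} \<and>
                 (\<exists>g\<in>S. [j - i = g] (mod n) \<or> [j - i = - g] (mod n))},
       tail = fst, head = snd \<rparr>"

lemma pseudo_graph_circulant_graph: "pseudo_graph (circulant_graph n S)"
proof
  have "arcs (circulant_graph n S) \<subseteq> {0..<n} \<times> {0..<n}"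
    by (auto simp: circulant_graph_def)
  then show "finite (arcs (circulant_graph n S))"
    by (rule finite_subset) simp
  have neg: "[i - j = - a] (mod n)" if "[j - i = a] (mod n)" for i j a :: int
    using cong_minus_minus_iff[of "j - i" a n] that by simp
  have "(j, i) \<in> arcs (circulant_graph n S)" if "(i, j) \<in> arcs (circulant_graph n S)" for i j
    using that neg[of j i] by (simp add: circulant_graph_def) (metis minus_minus)
  then show "symmetric (circulant_graph n S)"
    by (force simp: symmetric_conv circulant_graph_def)
qed (auto simp: circulant_graph_def)

text \<open>
  With unit arc weights, the shortest-path cost \<open>\<mu>\<close> is the graph distance, which is
  \<open>\<infinity>\<close> for vertices in different components; hence so is the diameter of a disconnected
  graph. On a finite nonempty vertex set the supremum is a maximum.
\<close>

definition graph_diameter :: "('a, 'b) pre_digraph \<Rightarrow> ereal" where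
  "graph_diameter G = (SUP (u, v) \<in> verts G \<times> verts G. wf_digraph.\<mu> G (\<lambda>_. 1) u v)"

text \<open>
  The divisions below are exact for \<open>k \<equiv> 1 (mod 5)\<close>, see \<open>LCC10_exact\<close> and
  \<open>LCC10_gens_exact\<close>.
\<close>

definition LCC10 :: "int \<Rightarrow> int" where
  "LCC10 k = (512*k^5 + 1280*k^4 + 6560*k^3 + 9520*k^2 + 6100*k + 1028) div 3125"

definition LCC10_gens :: "int \<Rightarrow> int set" where
  "LCC10_gens k =
     {1,
      (128*k^4 + 448*k^3 + 1688*k^2 + 3768*k + 843) div 625,
      (256*k^4 + 416*k^3 + 2816*k^2 + 2346*k + 416) div 625,
      (256*k^4 + 576*k^3 + 3136*k^2 + 3976*k + 1431) div 625,
      (384*k^4 + 864*k^3 + 4504*k^2 + 5614*k + 1134) div 625}"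

lemma LCC10_exact:
  assumes "[k = 1] (mod 5)"
  shows "3125 * LCC10 k = 512*k^5 + 1280*k^4 + 6560*k^3 + 9520*k^2 + 6100*k + 1028"
proof -
  obtain m where k: "k = 5*m + 1"
    using assms cong_iff_lin[of 1 k 5] by (auto simp: cong_sym_eq)
  have "512*k^5 + 1280*k^4 + 6560*k^3 + 9520*k^2 + 6100*k + 1028 =
        3125 * (512*m^5 + 768*m^4 + 672*m^3 + 336*m^2 + 84*m + 8)"
    by (simp add: k eval_nat_numeral algebra_simps)
  then have "3125 dvd 512*k^5 + 1280*k^4 + 6560*k^3 + 9520*k^2 + 6100*k + 1028"
    by (rule dvdI)
  then show ?thesis
    unfolding LCC10_def by (rule dvd_mult_div_cancel)
qed

lemma LCC10_gens_exact:
  fixes k :: int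
  assumes "[k = 1] (mod 5)"
  shows "625 dvd 128*k^4 + 448*k^3 + 1688*k^2 + 3768*k + 843"
    and "625 dvd 256*k^4 + 416*k^3 + 2816*k^2 + 2346*k + 416"
    and "625 dvd 256*k^4 + 576*k^3 + 3136*k^2 + 3976*k + 1431"
    and "625 dvd 384*k^4 + 864*k^3 + 4504*k^2 + 5614*k + 1134"
proof -
  obtain m where k: "k = 5*m + 1"
    using assms cong_iff_lin[of 1 k 5] by (auto simp: cong_sym_eq)
  have "128*k^4 + 448*k^3 + 1688*k^2 + 3768*k + 843 = 625 * (128*m^4 + 192*m^3 + 152*m^2 + 72*m + 11)"
    by (simp add: k eval_nat_numeral algebra_simps)
  then show "625 dvd 128*k^4 + 448*k^3 + 1688*k^2 + 3768*k + 843" by (rule dvdI)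
  have "256*k^4 + 416*k^3 + 2816*k^2 + 2346*k + 416 = 625 * (256*m^4 + 288*m^3 + 224*m^2 + 82*m + 10)"
    by (simp add: k eval_nat_numeral algebra_simps)
  then show "625 dvd 256*k^4 + 416*k^3 + 2816*k^2 + 2346*k + 416" by (rule dvdI)
  have "256*k^4 + 576*k^3 + 3136*k^2 + 3976*k + 1431 = 625 * (256*m^4 + 320*m^3 + 256*m^2 + 104*m + 15)"
    by (simp add: k eval_nat_numeral algebra_simps)
  then show "625 dvd 256*k^4 + 576*k^3 + 3136*k^2 + 3976*k + 1431" by (rule dvdI)
  have "384*k^4 + 864*k^3 + 4504*k^2 + 5614*k + 1134 = 625 * (384*m^4 + 480*m^3 + 376*m^2 + 150*m + 20)"
    by (simp add: k eval_nat_numeral algebra_simps)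
  then show "625 dvd 384*k^4 + 864*k^3 + 4504*k^2 + 5614*k + 1134" by (rule dvdI)
qed

end

theory Submission
  imports Defs
begin

text \<open>
  Write \<open>k = 5m + 1\<close>. The diameter of the Cayley graph is the covering radius, in the
  \<open>l\<^sub>1\<close>-norm, of the lattice \<open>L\<close> of integer relations modulo \<open>n\<close> between the five generators.
  This lattice is generated by the rows \<open>W\<^sub>1, \<dots>, W\<^sub>5\<close> of
  \<open>4m I + diag(1, 2, 1, 1, 1) + A\<close> with \<open>A\<close> skew-symmetric with entries in \<open>{-1, 0, 1}\<close>,
  together with \<open>V = (W\<^sub>1 + \<dots> + W\<^sub>5) / 2\<close>; it is a perturbation of the body-centred cubic
  lattice scaled by \<open>2m\<close>. By skew-symmetry each of the vectors
  \<open>V\<^sub>\<epsilon> = (\<epsilon>\<^sub>1 W\<^sub>1 + \<dots> + \<epsilon>\<^sub>5 W\<^sub>5) / 2\<close>, for signs \<open>\<epsilon>\<^sub>i\<close>, has norm \<open>10m + 3\<close>.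

  Upper bound: let \<open>x\<close> have minimal norm in its coset of \<open>L\<close>. If no coordinate of \<open>x\<close> vanishes
  and \<open>\<epsilon>\<close> is its sign vector, then skew-symmetry turns \<open>\<parallel>x\<parallel> \<le> \<parallel>x - \<epsilon>\<^sub>i W\<^sub>i\<parallel>\<close> into the statement
  that the \<open>i\<close>-th coordinate of \<open>x\<close> is at most that of \<open>V\<^sub>\<epsilon>\<close> in absolute value. Hence
  \<open>\<parallel>x\<parallel> \<le> \<parallel>x - V\<^sub>\<epsilon>\<parallel> = 10m + 3 - \<parallel>x\<parallel>\<close> and so \<open>\<parallel>x\<parallel> \<le> 5m + 1\<close>. Vanishing coordinates have no
  preferred sign; they require comparison with further translates, but still only finitely many.

  Lower bound: the point \<open>(m+1, m+1, m, m, m)\<close> has distance \<open>5m + 2\<close> from \<open>0\<close> and \<open>5m + 1\<close>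
  from \<open>V\<close>, and these are the lattice points nearest to it.
\<close>

section \<open>Distances in circulant graphs\<close>

lemma circulant_awalk_imp_word:
  assumes "pre_digraph.awalk (circulant_graph n S) u p v"
  shows "\<exists>xs. set xs \<subseteq> S \<union> uminus ` S \<and> length xs = length p \<and> [v - u = sum_list xs] (mod n)"
proof -
  interpret pseudo_graph "circulant_graph n S" by (rule pseudo_graph_circulant_graph)
  show ?thesis using assms
  proof (induction p arbitrary: u)
    case Nil
    then have "u = v" by (simp add: awalk_Nil_iff)
    then show ?case by simp
  next
    case (Cons e p)
    then have e: "e \<in> arcs (circulant_graph n S)" "fst e = u" and p: "awalk (snd e) p v"
      by (simp_all add: awalk_Cons_iff) (simp_all add: circulant_graph_def)
    obtain xs where xs: "set xs \<subseteq> S \<union> uminus ` S" "length xs = length p"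
      "[v - snd e = sum_list xs] (mod n)"
      using Cons.IH[OF p] by blast
    have "\<exists>g\<in>S. [snd e - u = g] (mod n) \<or> [snd e - u = - g] (mod n)"
      using e by (auto simp: circulant_graph_def)
    then obtain g where g: "g \<in> S \<union> uminus ` S" "[snd e - u = g] (mod n)"
      by blast
    have "[snd e - u + (v - snd e) = g + sum_list xs] (mod n)"
      using g(2) xs(3) by (rule cong_add)
    then show ?case
      using g(1) xs(1,2) by (intro exI[of _ "g # xs"]) simp
  qed
qed

lemma circulant_word_imp_awalk:
  assumes "n > 0" "v \<in> {0..<n}" "u \<in> {0..<n}"
    and "set xs \<subseteq> S \<union> uminus ` S" "[v - u = sum_list xs] (mod n)"
  shows "\<exists>p. pre_digraph.awalk (circulant_graph n S) u p v \<and> length p = length xs"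
proof -
  interpret pseudo_graph "circulant_graph n S" by (rule pseudo_graph_circulant_graph)
  show ?thesis using assms(3-)
  proof (induction xs arbitrary: u)
    case Nil
    then have "n dvd v - u" by (simp add: cong_0_iff)
    then have "v mod n = u mod n" by (simp add: mod_eq_dvd_iff)
    then have "u = v" using Nil assms(2) by simp
    then have "awalk u [] v" using Nil by (simp add: awalk_Nil_iff) (simp add: circulant_graph_def)
    then show ?case by (intro exI[of _ "[]"]) simp
  next
    case (Cons g xs)
    define w where "w = (u + g) mod n"
    have w: "w \<in> {0..<n}" using assms(1) by (simp add: w_def)
    have wg: "[w - u = g] (mod n)"
      by (simp add: w_def cong_def mod_diff_left_eq)
    have "[v - u - (w - u) = g + sum_list xs - g] (mod n)"
      using Cons.prems(3) wg by (intro cong_diff) simp_all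
    then have "[v - w = sum_list xs] (mod n)" by simp
    then obtain p where p: "awalk w p v" "length p = length xs"
      using Cons.IH[OF w] Cons.prems(2) by auto
    have "(u, w) \<in> arcs (circulant_graph n S)"
      using Cons.prems w wg by (auto simp: circulant_graph_def)
    then have "awalk u ((u, w) # p) v"
      using p(1) by (simp add: awalk_Cons_iff) (simp add: circulant_graph_def)
    then show ?case using p(2) by (intro exI[of _ "(u, w) # p"]) simp
  qed
qed

text \<open>Distances depend only on the difference of the endpoints, so words representing every
  residue \<open>d\<close> bound the diameter, and the pair \<open>(0, r mod n)\<close> attains
  it.\<close>

lemma circulant_diameter_eqI:
  assumes "n > 0"
    and upper: "\<And>d. \<exists>xs. set xs \<subseteq> S \<union> uminus ` S \<and> length xs \<le> k \<and> [d = sum_list xs] (mod n)"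
    and lower: "\<And>xs. set xs \<subseteq> S \<union> uminus ` S \<Longrightarrow> [r = sum_list xs] (mod n) \<Longrightarrow> k \<le> length xs"
  shows "graph_diameter (circulant_graph n S) = ereal (real k)"
proof -
  interpret pseudo_graph "circulant_graph n S" by (rule pseudo_graph_circulant_graph)
  have verts: "verts (circulant_graph n S) = {0..<n}" by (simp add: circulant_graph_def)
  have cost: "awalk_cost (\<lambda>_. 1) p = real (length p)" for p :: "(int \<times> int) list"
    by (induction p) simp_all
  have le: "\<mu> (\<lambda>_. 1) u v \<le> ereal (real k)" if uv: "u \<in> {0..<n}" "v \<in> {0..<n}" for u v
  proof -
    obtain xs where xs: "set xs \<subseteq> S \<union> uminus ` S" "length xs \<le> k" "[v - u = sum_list xs] (mod n)"
      using upper by blast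
    obtain p where "awalk u p v" "length p = length xs"
      using circulant_word_imp_awalk[OF assms(1) uv(2,1) xs(1,3)] by blast
    then show ?thesis
      using min_cost_le_walk_cost[of u p v "\<lambda>_. 1"] xs(2) cost[of p]
      by (metis ereal_less_eq(3) of_nat_le_iff order_trans)
  qed
  have r: "0 \<in> {0..<n}" "r mod n \<in> {0..<n}" using assms(1) by simp_all
  have "ereal (real k) \<le> \<mu> (\<lambda>_. 1) 0 (r mod n)"
    unfolding \<mu>_def
  proof (rule INF_greatest)
    fix p assume "p \<in> {p. awalk 0 p (r mod n)}"
    then obtain xs where xs: "set xs \<subseteq> S \<union> uminus ` S" "length xs = length p"
      "[r mod n - 0 = sum_list xs] (mod n)"
      using circulant_awalk_imp_word by blast
    then have "k \<le> length xs" by (intro lower) (simp_all add: cong_def)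
    then show "ereal (real k) \<le> ereal (awalk_cost (\<lambda>_. 1) p)"
      using xs(2) by (simp add: cost)
  qed
  then show ?thesis
    unfolding graph_diameter_def verts
    by (intro antisym SUP_least) (auto intro!: le SUP_upper2[of "(0, r mod n)"] simp: r[simplified])
qed

section \<open>Words in the generators as integer vectors\<close>

definition l1 :: "int \<Rightarrow> int \<Rightarrow> int \<Rightarrow> int \<Rightarrow> int \<Rightarrow> int" where
  "l1 x1 x2 x3 x4 x5 = \<bar>x1\<bar> + \<bar>x2\<bar> + \<bar>x3\<bar> + \<bar>x4\<bar> + \<bar>x5\<bar>"

lemma l1_nonneg: "0 \<le> l1 x1 x2 x3 x4 x5"
  by (simp add: l1_def)

lemma word_of_multiple:
  fixes y g :: int
  shows "\<exists>xs. set xs \<subseteq> {g, - g} \<and> int (length xs) = \<bar>y\<bar> \<and> sum_list xs = y * g"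
  by (rule exI[of _ "replicate (nat \<bar>y\<bar>) (if y \<ge> 0 then g else - g)"])
     (auto simp: sum_list_replicate)

lemma word_of_vector:
  fixes y1 y2 y3 y4 y5 g1 g2 g3 g4 g5 :: int
  defines "S \<equiv> {g1, g2, g3, g4, g5}"
  shows "\<exists>xs. set xs \<subseteq> S \<union> uminus ` S \<and> int (length xs) = l1 y1 y2 y3 y4 y5 \<and>
    sum_list xs = y1*g1 + y2*g2 + y3*g3 + y4*g4 + y5*g5"
proof -
  obtain w1 w2 w3 w4 w5
    where "set w1 \<subseteq> {g1, - g1}" "int (length w1) = \<bar>y1\<bar>" "sum_list w1 = y1 * g1"
      and "set w2 \<subseteq> {g2, - g2}" "int (length w2) = \<bar>y2\<bar>" "sum_list w2 = y2 * g2"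
      and "set w3 \<subseteq> {g3, - g3}" "int (length w3) = \<bar>y3\<bar>" "sum_list w3 = y3 * g3"
      and "set w4 \<subseteq> {g4, - g4}" "int (length w4) = \<bar>y4\<bar>" "sum_list w4 = y4 * g4"
      and "set w5 \<subseteq> {g5, - g5}" "int (length w5) = \<bar>y5\<bar>" "sum_list w5 = y5 * g5"
    using word_of_multiple by meson
  then show ?thesis
    by (intro exI[of _ "w1 @ w2 @ w3 @ w4 @ w5"]) (auto simp: S_def l1_def)
qed

text \<open>Only an inequality, since letters of opposite sign cancel.\<close>

lemma vector_of_word:
  fixes g1 g2 g3 g4 g5 :: int
  assumes "set xs \<subseteq> {g1, g2, g3, g4, g5} \<union> uminus ` {g1, g2, g3, g4, g5}"
  shows "\<exists>y1 y2 y3 y4 y5. l1 y1 y2 y3 y4 y5 \<le> int (length xs) \<and>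
    sum_list xs = y1*g1 + y2*g2 + y3*g3 + y4*g4 + y5*g5"
  using assms
proof (induction xs)
  case Nil
  show ?case by (intro exI[of _ 0]) (simp add: l1_def)
next
  case (Cons x xs)
  then obtain y1 y2 y3 y4 y5 where y: "l1 y1 y2 y3 y4 y5 \<le> int (length xs)"
    "sum_list xs = y1*g1 + y2*g2 + y3*g3 + y4*g4 + y5*g5"
    by auto
  obtain e1 e2 e3 e4 e5 :: int where e: "x = e1*g1 + e2*g2 + e3*g3 + e4*g4 + e5*g5" "l1 e1 e2 e3 e4 e5 = 1"
  proof -
    from Cons.prems consider "x = g1" | "x = g2" | "x = g3" | "x = g4" | "x = g5"
      | "x = - g1" | "x = - g2" | "x = - g3" | "x = - g4" | "x = - g5"
      by auto
    then show thesis
      by cases (auto intro: that[of 1 0 0 0 0] that[of 0 1 0 0 0] that[of 0 0 1 0 0] that[of 0 0 0 1 0]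
          that[of 0 0 0 0 1] that[of "-1" 0 0 0 0] that[of 0 "-1" 0 0 0] that[of 0 0 "-1" 0 0]
          that[of 0 0 0 "-1" 0] that[of 0 0 0 0 "-1"] simp: l1_def)
  qed
  have "l1 (y1 + e1) (y2 + e2) (y3 + e3) (y4 + e4) (y5 + e5) \<le> int (length (x # xs))"
    using y(1) e(2) abs_triangle_ineq[of y1 e1] abs_triangle_ineq[of y2 e2]
      abs_triangle_ineq[of y3 e3] abs_triangle_ineq[of y4 e4] abs_triangle_ineq[of y5 e5]
    unfolding l1_def length_Cons of_nat_Suc by linarith
  moreover have "sum_list (x # xs) =
      (y1 + e1)*g1 + (y2 + e2)*g2 + (y3 + e3)*g3 + (y4 + e4)*g4 + (y5 + e5)*g5"
    using y(2) e(1) by (simp add: algebra_simps)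
  ultimately show ?case by blast
qed

lemma circulant5_diameter_eqI:
  fixes n k g1 g2 g3 g4 g5 :: int
  assumes "n > 0" "k \<ge> 0"
    and upper: "\<And>d. \<exists>y1 y2 y3 y4 y5. l1 y1 y2 y3 y4 y5 \<le> k \<and>
      [d = y1*g1 + y2*g2 + y3*g3 + y4*g4 + y5*g5] (mod n)"
    and lower: "\<And>y1 y2 y3 y4 y5. [r = y1*g1 + y2*g2 + y3*g3 + y4*g4 + y5*g5] (mod n) \<Longrightarrow>
      k \<le> l1 y1 y2 y3 y4 y5"
  shows "graph_diameter (circulant_graph n ((\<lambda>g. g mod n) ` {g1, g2, g3, g4, g5})) = ereal (of_int k)"
proof -
  let ?S = "{g1 mod n, g2 mod n, g3 mod n, g4 mod n, g5 mod n}"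
  have reduce: "[y1*(g1 mod n) + y2*(g2 mod n) + y3*(g3 mod n) + y4*(g4 mod n) + y5*(g5 mod n) =
      y1*g1 + y2*g2 + y3*g3 + y4*g4 + y5*g5] (mod n)" for y1 y2 y3 y4 y5
    by (intro cong_add cong_mult cong_refl) (simp_all add: cong_def)
  have "graph_diameter (circulant_graph n ?S) = ereal (real (nat k))"
  proof (rule circulant_diameter_eqI[OF assms(1)])
    fix d
    obtain y1 y2 y3 y4 y5 where y: "l1 y1 y2 y3 y4 y5 \<le> k"
      "[d = y1*g1 + y2*g2 + y3*g3 + y4*g4 + y5*g5] (mod n)"
      using upper by blast
    obtain xs where xs: "set xs \<subseteq> ?S \<union> uminus ` ?S" "int (length xs) = l1 y1 y2 y3 y4 y5"
      "sum_list xs = y1*(g1 mod n) + y2*(g2 mod n) + y3*(g3 mod n) + y4*(g4 mod n) + y5*(g5 mod n)"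
      using word_of_vector by metis
    have "[d = sum_list xs] (mod n)"
      unfolding xs(3) using y(2) reduce cong_sym cong_trans by blast
    moreover have "length xs \<le> nat k" using xs(2) y(1) by simp
    ultimately show "\<exists>xs. set xs \<subseteq> ?S \<union> uminus ` ?S \<and> length xs \<le> nat k \<and> [d = sum_list xs] (mod n)"
      using xs(1) by blast
  next
    fix xs assume xs: "set xs \<subseteq> ?S \<union> uminus ` ?S" "[r = sum_list xs] (mod n)"
    obtain y1 y2 y3 y4 y5 where y: "l1 y1 y2 y3 y4 y5 \<le> int (length xs)"
      "sum_list xs = y1*(g1 mod n) + y2*(g2 mod n) + y3*(g3 mod n) + y4*(g4 mod n) + y5*(g5 mod n)"
      using vector_of_word[OF xs(1)] by blast
    have "[r = y1*g1 + y2*g2 + y3*g3 + y4*g4 + y5*g5] (mod n)"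
      using xs(2) reduce unfolding y(2) by (rule cong_trans)
    then have "k \<le> l1 y1 y2 y3 y4 y5" by (rule lower)
    then show "nat k \<le> length xs" using y(1) by simp
  qed
  then show ?thesis using assms(2) by simp
qed

section \<open>The lattice of relations between the generators\<close>

text \<open>
  The coordinates of \<open>t V + b\<^sub>1 W\<^sub>1 + \<dots> + b\<^sub>5 W\<^sub>5\<close>, where \<open>V = (2m+1, 2m+1, 2m, 2m, 2m+1)\<close>.
\<close>

definition lat1 :: "int \<Rightarrow> int \<Rightarrow> int \<Rightarrow> int \<Rightarrow> int \<Rightarrow> int \<Rightarrow> int \<Rightarrow> int" where
  "lat1 m t b1 b2 b3 b4 b5 = (2*m + 1)*t + (4*m + 1)*b1 + b2 + b3 - b5"

definition lat2 :: "int \<Rightarrow> int \<Rightarrow> int \<Rightarrow> int \<Rightarrow> int \<Rightarrow> int \<Rightarrow> int \<Rightarrow> int" where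
  "lat2 m t b1 b2 b3 b4 b5 = (2*m + 1)*t - b1 + (4*m + 2)*b2 + b4"

definition lat3 :: "int \<Rightarrow> int \<Rightarrow> int \<Rightarrow> int \<Rightarrow> int \<Rightarrow> int \<Rightarrow> int \<Rightarrow> int" where
  "lat3 m t b1 b2 b3 b4 b5 = 2*m*t - b1 + (4*m + 1)*b3 + b4 - b5"

definition lat4 :: "int \<Rightarrow> int \<Rightarrow> int \<Rightarrow> int \<Rightarrow> int \<Rightarrow> int \<Rightarrow> int \<Rightarrow> int" where
  "lat4 m t b1 b2 b3 b4 b5 = 2*m*t - b2 - b3 + (4*m + 1)*b4 + b5"

definition lat5 :: "int \<Rightarrow> int \<Rightarrow> int \<Rightarrow> int \<Rightarrow> int \<Rightarrow> int \<Rightarrow> int \<Rightarrow> int" where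
  "lat5 m t b1 b2 b3 b4 b5 = (2*m + 1)*t + b1 + b3 - b4 + (4*m + 1)*b5"

lemmas lat_defs = lat1_def lat2_def lat3_def lat4_def lat5_def

text \<open>The order and, below, the last four generators as polynomials in \<open>m\<close>, where
  k = 5m + 1.\<close>

definition cc_order :: "int \<Rightarrow> int" where
  "cc_order m = 512*m^5 + 768*m^4 + 672*m^3 + 336*m^2 + 84*m + 8"

definition cc_gen2 :: "int \<Rightarrow> int" where
  "cc_gen2 m = 128*m^4 + 192*m^3 + 152*m^2 + 72*m + 11"

definition cc_gen3 :: "int \<Rightarrow> int" where
  "cc_gen3 m = 256*m^4 + 288*m^3 + 224*m^2 + 82*m + 10"

definition cc_gen4 :: "int \<Rightarrow> int" where
  "cc_gen4 m = 256*m^4 + 320*m^3 + 256*m^2 + 104*m + 15"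

definition cc_gen5 :: "int \<Rightarrow> int" where
  "cc_gen5 m = 384*m^4 + 480*m^3 + 376*m^2 + 150*m + 20"

lemmas cc_defs = cc_order_def cc_gen2_def cc_gen3_def cc_gen4_def cc_gen5_def

definition cc_value :: "int \<Rightarrow> int \<Rightarrow> int \<Rightarrow> int \<Rightarrow> int \<Rightarrow> int \<Rightarrow> int" where
  "cc_value m y1 y2 y3 y4 y5 =
    y1*1 + y2*cc_gen2 m + y3*cc_gen3 m + y4*cc_gen4 m + y5*cc_gen5 m"

lemma cc_value_diff:
  "cc_value m (x1 - y1) (x2 - y2) (x3 - y3) (x4 - y4) (x5 - y5) =
    cc_value m x1 x2 x3 x4 x5 - cc_value m y1 y2 y3 y4 y5"
  by (simp add: cc_value_def algebra_simps)

text \<open>\<open>V\<close> has value 4n and \<open>W\<^sub>1\<close>, ...,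
  \<open>W\<^sub>5\<close> have values 0, n, 2n, 2n, 3n, so every lattice vector is a relation
  modulo n.\<close>

lemma cc_value_lat:
  "cc_value m (lat1 m t b1 b2 b3 b4 b5) (lat2 m t b1 b2 b3 b4 b5) (lat3 m t b1 b2 b3 b4 b5)
     (lat4 m t b1 b2 b3 b4 b5) (lat5 m t b1 b2 b3 b4 b5) =
   cc_order m * (4*t + b2 + 2*b3 + 2*b4 + 3*b5)"
  unfolding cc_value_def lat_defs cc_defs by algebra

text \<open>
  The vectors \<open>V, W\<^sub>1, W\<^sub>2, W\<^sub>3, W\<^sub>4\<close> already form a basis of \<open>L\<close>. The polynomials in the proof
  express in this basis the generators \<open>(n, 0, 0, 0, 0)\<close> and \<open>e\<^sub>j - g\<^sub>j e\<^sub>1\<close> of \<open>L\<close>.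
\<close>

lemma cc_value_kernel:
  assumes "cc_order m dvd cc_value m y1 y2 y3 y4 y5"
  obtains t b1 b2 b3 b4 where
    "y1 = lat1 m t b1 b2 b3 b4 0" "y2 = lat2 m t b1 b2 b3 b4 0" "y3 = lat3 m t b1 b2 b3 b4 0"
    "y4 = lat4 m t b1 b2 b3 b4 0" "y5 = lat5 m t b1 b2 b3 b4 0"
proof -
  obtain q where q: "cc_value m y1 y2 y3 y4 y5 = cc_order m * q"
    using assms by (rule dvdE)
  define t where "t = - (4 + 32*m + 80*m^2 + 64*m^3)*q + (6 + 20*m + 16*m^2)*y2
    + (5 + 28*m + 32*m^2)*y3 + (8 + 32*m + 32*m^2)*y4 + (11 + 48*m + 48*m^2)*y5"
  define b1 where "b1 = (7 + 52*m + 144*m^2 + 192*m^3 + 128*m^4)*q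
    - (10 + 32*m + 48*m^2 + 32*m^3)*y2 - (9 + 44*m + 72*m^2 + 64*m^3)*y3
    - (13 + 52*m + 80*m^2 + 64*m^3)*y4 - (18 + 76*m + 120*m^2 + 96*m^3)*y5"
  define b2 where "b2 = (3 + 24*m + 64*m^2 + 64*m^3)*q - (4 + 16*m + 16*m^2)*y2
    - (4 + 20*m + 32*m^2)*y3 - (6 + 24*m + 32*m^2)*y4 - (8 + 36*m + 48*m^2)*y5"
  define b3 where "b3 = (2 + 20*m + 64*m^2 + 64*m^3)*q - (3 + 16*m + 16*m^2)*y2
    - (2 + 20*m + 32*m^2)*y3 - (4 + 24*m + 32*m^2)*y4 - (5 + 36*m + 48*m^2)*y5"
  define b4 where "b4 = (5 + 32*m + 64*m^2 + 32*m^3)*q - (7 + 16*m + 8*m^2)*y2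
    - (6 + 26*m + 16*m^2)*y3 - (9 + 28*m + 16*m^2)*y4 - (13 + 42*m + 24*m^2)*y5"
  \<comment> \<open>The first generator is 1, so \<open>q\<close> and the other coordinates
    determine \<open>y1\<close>; the five equations become polynomial identities.\<close>
  have y1: "y1 = cc_order m * q
      - (y2*cc_gen2 m + y3*cc_gen3 m + y4*cc_gen4 m + y5*cc_gen5 m)"
    using q by (simp add: cc_value_def)
  show thesis
  proof (rule that[of t b1 b2 b3 b4])
    show "y1 = lat1 m t b1 b2 b3 b4 0"
      unfolding y1 lat_defs cc_defs t_def b1_def b2_def b3_def b4_def by algebra
  qed (unfold lat_defs t_def b1_def b2_def b3_def b4_def, algebra+)
qed

section \<open>The covering radius\<close>

text \<open>
  The translates used are by \<open>\<plusminus>W\<^sub>i\<close>, by \<open>\<plusminus>W\<^sub>i \<plusminus> W\<^sub>j\<close> and by all the \<open>V\<^sub>\<epsilon>\<close>; what remains is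
  linear integer arithmetic.
\<close>

lemma l1_reduced_le:
  fixes m x1 x2 x3 x4 x5 :: int
  assumes "m \<ge> 1"
    and minimal: "\<And>t b1 b2 b3 b4 b5. l1 x1 x2 x3 x4 x5 \<le>
      l1 (x1 - lat1 m t b1 b2 b3 b4 b5) (x2 - lat2 m t b1 b2 b3 b4 b5)
         (x3 - lat3 m t b1 b2 b3 b4 b5) (x4 - lat4 m t b1 b2 b3 b4 b5)
         (x5 - lat5 m t b1 b2 b3 b4 b5)"
  shows "l1 x1 x2 x3 x4 x5 \<le> 5*m + 1"
proof -
  define s where "s = l1 x1 x2 x3 x4 x5"
  note min = minimal[folded s_def, unfolded l1_def lat_defs]
  \<comment> \<open>For \<open>t = 1\<close> and all \<open>bi\<close> in {0, -1} the translate is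
    by \<open>V\<^sub>\<epsilon>\<close> with signs 1 + 2 \<open>bi\<close>.\<close>
  note translates =
    min[of 0 1 0 0 0 0] min[of 0 "-1" 0 0 0 0] min[of 0 0 1 0 0 0] min[of 0 0 "-1" 0 0 0]
    min[of 0 0 0 1 0 0] min[of 0 0 0 "-1" 0 0] min[of 0 0 0 0 1 0] min[of 0 0 0 0 "-1" 0]
    min[of 0 0 0 0 0 1] min[of 0 0 0 0 0 "-1"] min[of 0 1 1 0 0 0] min[of 0 1 "-1" 0 0 0]
    min[of 0 "-1" 1 0 0 0] min[of 0 "-1" "-1" 0 0 0] min[of 0 1 0 1 0 0]
    min[of 0 1 0 "-1" 0 0] min[of 0 "-1" 0 1 0 0] min[of 0 "-1" 0 "-1" 0 0]
    min[of 0 1 0 0 1 0] min[of 0 1 0 0 "-1" 0] min[of 0 "-1" 0 0 1 0]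
    min[of 0 "-1" 0 0 "-1" 0] min[of 0 1 0 0 0 1] min[of 0 1 0 0 0 "-1"]
    min[of 0 "-1" 0 0 0 1] min[of 0 "-1" 0 0 0 "-1"] min[of 0 0 1 1 0 0]
    min[of 0 0 1 "-1" 0 0] min[of 0 0 "-1" 1 0 0] min[of 0 0 "-1" "-1" 0 0]
    min[of 0 0 1 0 1 0] min[of 0 0 1 0 "-1" 0] min[of 0 0 "-1" 0 1 0]
    min[of 0 0 "-1" 0 "-1" 0] min[of 0 0 1 0 0 1] min[of 0 0 1 0 0 "-1"]
    min[of 0 0 "-1" 0 0 1] min[of 0 0 "-1" 0 0 "-1"] min[of 0 0 0 1 1 0]
    min[of 0 0 0 1 "-1" 0] min[of 0 0 0 "-1" 1 0] min[of 0 0 0 "-1" "-1" 0]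
    min[of 0 0 0 1 0 1] min[of 0 0 0 1 0 "-1"] min[of 0 0 0 "-1" 0 1]
    min[of 0 0 0 "-1" 0 "-1"] min[of 0 0 0 0 1 1] min[of 0 0 0 0 1 "-1"]
    min[of 0 0 0 0 "-1" 1] min[of 0 0 0 0 "-1" "-1"] min[of 1 0 0 0 0 0]
    min[of 1 0 0 0 0 "-1"] min[of 1 0 0 0 "-1" 0] min[of 1 0 0 0 "-1" "-1"]
    min[of 1 0 0 "-1" 0 0] min[of 1 0 0 "-1" 0 "-1"] min[of 1 0 0 "-1" "-1" 0]
    min[of 1 0 0 "-1" "-1" "-1"] min[of 1 0 "-1" 0 0 0] min[of 1 0 "-1" 0 0 "-1"]
    min[of 1 0 "-1" 0 "-1" 0] min[of 1 0 "-1" 0 "-1" "-1"] min[of 1 0 "-1" "-1" 0 0]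
    min[of 1 0 "-1" "-1" 0 "-1"] min[of 1 0 "-1" "-1" "-1" 0] min[of 1 0 "-1" "-1" "-1" "-1"]
    min[of 1 "-1" 0 0 0 0] min[of 1 "-1" 0 0 0 "-1"] min[of 1 "-1" 0 0 "-1" 0]
    min[of 1 "-1" 0 0 "-1" "-1"] min[of 1 "-1" 0 "-1" 0 0] min[of 1 "-1" 0 "-1" 0 "-1"]
    min[of 1 "-1" 0 "-1" "-1" 0] min[of 1 "-1" 0 "-1" "-1" "-1"] min[of 1 "-1" "-1" 0 0 0]
    min[of 1 "-1" "-1" 0 0 "-1"] min[of 1 "-1" "-1" 0 "-1" 0] min[of 1 "-1" "-1" 0 "-1" "-1"]
    min[of 1 "-1" "-1" "-1" 0 0] min[of 1 "-1" "-1" "-1" 0 "-1"]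
    min[of 1 "-1" "-1" "-1" "-1" 0] min[of 1 "-1" "-1" "-1" "-1" "-1"]
  have "s \<le> 5*m + 1"
    using \<open>m \<ge> 1\<close> s_def[unfolded l1_def] translates[simplified]
    using [[smt_reconstruction_step_timeout = 600]] by (smt (z3))
  then show ?thesis by (simp add: s_def)
qed

lemma ex_short_vector:
  assumes "m \<ge> 0"
  shows "\<exists>y1 y2 y3 y4 y5. l1 y1 y2 y3 y4 y5 \<le> 5*m + 1 \<and>
    [d = cc_value m y1 y2 y3 y4 y5] (mod cc_order m)"
proof (cases "m = 0")
  case True
  \<comment> \<open>Here n = 8 and the generators reduce to 1, 3, 2, 7, 4, so each nonzero residue
    is plus or minus a generator.\<close>
  have witness: ?thesis
    if "l1 y1 y2 y3 y4 y5 \<le> 1" "d mod 8 = (y1 + y2*11 + y3*10 + y4*15 + y5*20) mod 8"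
    for y1 y2 y3 y4 y5
    using that True by (force simp: cong_def cc_value_def cc_defs)
  have "d mod 8 \<in> {0..<8}" by simp
  then consider "d mod 8 = 0" | "d mod 8 = 1" | "d mod 8 = 2" | "d mod 8 = 3" | "d mod 8 = 4"
    | "d mod 8 = 5" | "d mod 8 = 6" | "d mod 8 = 7"
    by force
  then show ?thesis
  proof cases
    case 1 then show ?thesis by (intro witness[of 0 0 0 0 0]) (simp_all add: l1_def)
  next
    case 2 then show ?thesis by (intro witness[of 1 0 0 0 0]) (simp_all add: l1_def)
  next
    case 3 then show ?thesis by (intro witness[of 0 0 1 0 0]) (simp_all add: l1_def)
  next
    case 4 then show ?thesis by (intro witness[of 0 1 0 0 0]) (simp_all add: l1_def)
  next
    case 5 then show ?thesis by (intro witness[of 0 0 0 0 1]) (simp_all add: l1_def)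
  next
    case 6 then show ?thesis by (intro witness[of 0 "-1" 0 0 0]) (simp_all add: l1_def)
  next
    case 7 then show ?thesis by (intro witness[of 0 0 "-1" 0 0]) (simp_all add: l1_def)
  next
    case 8 then show ?thesis by (intro witness[of "-1" 0 0 0 0]) (simp_all add: l1_def)
  qed
next
  case False
  define P where "P k \<longleftrightarrow> (\<exists>y1 y2 y3 y4 y5. nat (l1 y1 y2 y3 y4 y5) = k \<and>
    [d = cc_value m y1 y2 y3 y4 y5] (mod cc_order m))" for k
  \<comment> \<open>The first generator alone represents \<open>d\<close>.\<close>
  have "P (nat (l1 d 0 0 0 0))"
    unfolding P_def cc_value_def by (intro exI[of _ d] exI[of _ 0]) simp
  then have "P (LEAST k. P k)" by (rule LeastI)
  then obtain x1 x2 x3 x4 x5 where x: "nat (l1 x1 x2 x3 x4 x5) = (LEAST k. P k)"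
    "[d = cc_value m x1 x2 x3 x4 x5] (mod cc_order m)"
    unfolding P_def by blast
  have "l1 x1 x2 x3 x4 x5 \<le> 5*m + 1"
  proof (rule l1_reduced_le)
    fix t b1 b2 b3 b4 b5
    let ?y1 = "x1 - lat1 m t b1 b2 b3 b4 b5" and ?y2 = "x2 - lat2 m t b1 b2 b3 b4 b5"
      and ?y3 = "x3 - lat3 m t b1 b2 b3 b4 b5" and ?y4 = "x4 - lat4 m t b1 b2 b3 b4 b5"
      and ?y5 = "x5 - lat5 m t b1 b2 b3 b4 b5"
    have "[d = cc_value m ?y1 ?y2 ?y3 ?y4 ?y5] (mod cc_order m)"
      unfolding cc_value_diff cc_value_lat
      using x(2) by (simp add: cong_def mod_diff_right_eq[symmetric])
    then have "P (nat (l1 ?y1 ?y2 ?y3 ?y4 ?y5))" unfolding P_def by blast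
    then have "nat (l1 x1 x2 x3 x4 x5) \<le> nat (l1 ?y1 ?y2 ?y3 ?y4 ?y5)"
      unfolding x(1) by (rule Least_le)
    then show "l1 x1 x2 x3 x4 x5 \<le> l1 ?y1 ?y2 ?y3 ?y4 ?y5"
      by (simp add: nat_le_eq_zle l1_nonneg)
  qed (use assms False in simp)
  then show ?thesis using x(2) by blast
qed

text \<open>
  With \<open>a\<^sub>i = t + 2 b\<^sub>i\<close> the lattice vector is \<open>(a\<^sub>1 W\<^sub>1 + \<dots> + a\<^sub>5 W\<^sub>5) / 2\<close>, and the \<open>a\<^sub>i\<close> all
  have the same parity: each satisfies \<open>a\<^sub>i \<ge> l\<close> or \<open>a\<^sub>i \<le> -u\<close> with \<open>(l, u) = (2, 0)\<close> if they are
  even and \<open>(1, 1)\<close> if they are odd. The next lemma replaces the product \<open>m a\<^sub>i\<close>, which occurs in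
  the \<open>i\<close>-th coordinate, by linear bounds in these two cases.
\<close>

lemma abs_diff_ge_of_parity:
  fixes m x c r h l u :: int
  assumes "m \<ge> 1" and c: "2*c = 4*(m*x) + r" and "x \<ge> l \<or> x \<le> - u"
  shows "x \<ge> l \<and> 2*\<bar>h - c\<bar> \<ge> 4*(l*m) + 4*x - 4*l + r - 2*h \<or>
    x \<le> - u \<and> 2*\<bar>h - c\<bar> \<ge> 2*h - 4*x - 4*u + 4*(u*m) - r"
proof -
  obtain z where z_def: "z = \<bar>h - c\<bar>" and z: "c - h \<le> z" "h - c \<le> z" by simp
  have "2*z \<ge> 4*(l*m) + 4*x - 4*l + r - 2*h" if "x \<ge> l"
  proof -
    have "m*x \<ge> l*m + x - l"
      using mult_nonneg_nonneg[of "m - 1" "x - l"] that assms(1) by (simp add: algebra_simps)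
    then show ?thesis using c z by linarith
  qed
  moreover have "2*z \<ge> 2*h - 4*x - 4*u + 4*(u*m) - r" if "x \<le> - u"
  proof -
    have "m*x \<le> x + u - u*m"
      using mult_nonneg_nonneg[of "m - 1" "- u - x"] that assms(1) by (simp add: algebra_simps)
    then show ?thesis using c z by linarith
  qed
  ultimately show ?thesis using assms(3) unfolding z_def by blast
qed

text \<open>A row of \<open>A\<close> has at most three nonzero entries, so in the sum of the five
  doubled bounds each absolute value of \<open>ai\<close> has coefficient at least 4 + 1 - 3 > 0.
  The smallest admissible \<open>ai\<close> are thus the worst case; for odd \<open>t\<close> these
  give the vectors \<open>V\<^sub>\<epsilon>\<close>.\<close>

lemma l1_deep_hole_ge:
  fixes m t b1 b2 b3 b4 b5 :: int
  assumes "m \<ge> 1"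
  shows "5*m + 1 \<le>
    l1 (m + 1 - lat1 m t b1 b2 b3 b4 b5) (m + 1 - lat2 m t b1 b2 b3 b4 b5)
       (m - lat3 m t b1 b2 b3 b4 b5) (m - lat4 m t b1 b2 b3 b4 b5) (m - lat5 m t b1 b2 b3 b4 b5)"
proof -
  define a1 a2 a3 a4 a5
    where a: "a1 = t + 2*b1" "a2 = t + 2*b2" "a3 = t + 2*b3" "a4 = t + 2*b4" "a5 = t + 2*b5"
  define z1 z2 z3 z4 z5 where z: "z1 = \<bar>m + 1 - lat1 m t b1 b2 b3 b4 b5\<bar>"
    "z2 = \<bar>m + 1 - lat2 m t b1 b2 b3 b4 b5\<bar>" "z3 = \<bar>m - lat3 m t b1 b2 b3 b4 b5\<bar>"
    "z4 = \<bar>m - lat4 m t b1 b2 b3 b4 b5\<bar>" "z5 = \<bar>m - lat5 m t b1 b2 b3 b4 b5\<bar>"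
  have double: "2 * lat1 m t b1 b2 b3 b4 b5 = 4*(m*a1) + (a1 + a2 + a3 - a5)"
    "2 * lat2 m t b1 b2 b3 b4 b5 = 4*(m*a2) + (2*a2 - a1 + a4)"
    "2 * lat3 m t b1 b2 b3 b4 b5 = 4*(m*a3) + (a3 - a1 + a4 - a5)"
    "2 * lat4 m t b1 b2 b3 b4 b5 = 4*(m*a4) + (a4 - a2 - a3 + a5)"
    "2 * lat5 m t b1 b2 b3 b4 b5 = 4*(m*a5) + (a5 + a1 + a3 - a4)"
    unfolding lat_defs a by (simp_all add: algebra_simps)
  note coord = double[THEN abs_diff_ge_of_parity[OF assms]]
  have "5*m + 1 \<le> z1 + z2 + z3 + z4 + z5"
  proof (cases "even t")
    case True
    then have "a1 \<ge> 2 \<or> a1 \<le> - 0" "a2 \<ge> 2 \<or> a2 \<le> - 0" "a3 \<ge> 2 \<or> a3 \<le> - 0"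
      "a4 \<ge> 2 \<or> a4 \<le> - 0" "a5 \<ge> 2 \<or> a5 \<le> - 0"
      unfolding a by presburger+
    from coord(1)[OF this(1), of "m + 1"] coord(2)[OF this(2), of "m + 1"]
      coord(3)[OF this(3), of m] coord(4)[OF this(4), of m] coord(5)[OF this(5), of m]
    show ?thesis
      unfolding z[symmetric] distrib_left_numeral mult_1_left mult_zero_left mult_zero_right
      using assms by (elim disjE conjE) linarith+
  next
    case False
    then have "a1 \<ge> 1 \<or> a1 \<le> - 1" "a2 \<ge> 1 \<or> a2 \<le> - 1" "a3 \<ge> 1 \<or> a3 \<le> - 1"
      "a4 \<ge> 1 \<or> a4 \<le> - 1" "a5 \<ge> 1 \<or> a5 \<le> - 1"
      unfolding a by presburger+
    from coord(1)[OF this(1), of "m + 1"] coord(2)[OF this(2), of "m + 1"]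
      coord(3)[OF this(3), of m] coord(4)[OF this(4), of m] coord(5)[OF this(5), of m]
    show ?thesis
      unfolding z[symmetric] distrib_left_numeral mult_1_left mult_zero_left mult_zero_right
      using assms by (elim disjE conjE) linarith+
  qed
  then show ?thesis unfolding z l1_def .
qed

lemma l1_ge_of_deep_hole_value:
  assumes "m \<ge> 0"
    and "[cc_value m (m + 1) (m + 1) m m m = cc_value m y1 y2 y3 y4 y5] (mod cc_order m)"
  shows "5*m + 1 \<le> l1 y1 y2 y3 y4 y5"
proof (cases "m = 0")
  \<comment> \<open>The point is now (1, 1, 0, 0, 0) with value 12, nonzero modulo 8, so only the
    zero vector has to be excluded.\<close>
  case True
  then show ?thesis using assms(2)
    by (cases "y1 = 0 \<and> y2 = 0 \<and> y3 = 0 \<and> y4 = 0 \<and> y5 = 0")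
       (auto simp: cc_value_def cc_defs l1_def cong_def)
next
  case False
  have "cc_order m dvd cc_value m (m + 1 - y1) (m + 1 - y2) (m - y3) (m - y4) (m - y5)"
    unfolding cc_value_diff using assms(2) by (simp add: cong_iff_dvd_diff)
  then obtain t b1 b2 b3 b4 where
    "m + 1 - y1 = lat1 m t b1 b2 b3 b4 0" "m + 1 - y2 = lat2 m t b1 b2 b3 b4 0"
    "m - y3 = lat3 m t b1 b2 b3 b4 0" "m - y4 = lat4 m t b1 b2 b3 b4 0"
    "m - y5 = lat5 m t b1 b2 b3 b4 0"
    by (rule cc_value_kernel)
  then have y: "y1 = m + 1 - lat1 m t b1 b2 b3 b4 0" "y2 = m + 1 - lat2 m t b1 b2 b3 b4 0"
    "y3 = m - lat3 m t b1 b2 b3 b4 0" "y4 = m - lat4 m t b1 b2 b3 b4 0"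
    "y5 = m - lat5 m t b1 b2 b3 b4 0"
    by linarith+
  show ?thesis unfolding y using assms(1) False by (intro l1_deep_hole_ge) simp
qed

section \<open>The generating set\<close>

lemma LCC10_eq_cc_order: "LCC10 (5*m + 1) = cc_order m"
proof -
  have "[5*m + 1 = 1] (mod 5)" by (simp add: cong_def)
  from LCC10_exact[OF this] have "3125 * LCC10 (5*m + 1) = 3125 * cc_order m"
    unfolding cc_defs by algebra
  then show ?thesis by simp
qed

lemma LCC10_gens_eq_cc_gens:
  "LCC10_gens (5*m + 1) = {1, cc_gen2 m, cc_gen3 m, cc_gen4 m, cc_gen5 m}"
proof -
  define k where "k = 5*m + 1"
  have "128*k^4 + 448*k^3 + 1688*k^2 + 3768*k + 843 = 625 * cc_gen2 m"
    "256*k^4 + 416*k^3 + 2816*k^2 + 2346*k + 416 = 625 * cc_gen3 m"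
    "256*k^4 + 576*k^3 + 3136*k^2 + 3976*k + 1431 = 625 * cc_gen4 m"
    "384*k^4 + 864*k^3 + 4504*k^2 + 5614*k + 1134 = 625 * cc_gen5 m"
    unfolding k_def cc_defs by algebra+
  then show ?thesis unfolding k_def[symmetric] LCC10_gens_def by simp
qed

lemma card_cc_gens:
  assumes "m \<ge> 0"
  shows "card ((\<lambda>g. g mod cc_order m) ` {1, cc_gen2 m, cc_gen3 m, cc_gen4 m, cc_gen5 m}) = 5"
proof (cases "m = 0")
  case True
  then show ?thesis by (simp add: cc_defs)
next
  case False
  have pos: "m \<ge> 1" "m^2 \<ge> 1" "m^3 \<ge> 1" "m^4 \<ge> 1" using assms False by simp_all
  \<comment> \<open>These bounds make the comparisons below linear in the powers of
    \<open>m\<close>.\<close>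
  have "m \<le> m^5" "m^2 \<le> m^5" "m^3 \<le> m^5" "m^4 \<le> m^5"
    using pos power_increasing[of _ 5 m] self_le_power[of m 5] by simp_all
  then have "1 < cc_gen2 m" "cc_gen2 m < cc_gen3 m" "cc_gen3 m < cc_gen4 m"
    "cc_gen4 m < cc_gen5 m" "cc_gen5 m < cc_order m"
    using pos unfolding cc_defs by linarith+
  then show ?thesis by simp
qed

theorem theorem4:
  fixes k n :: int and G :: "int set"
  assumes "k > 0" and "[k = 1] (mod 5)"
    and "n = LCC10 k"
    and "G = (\<lambda>g. g mod n) ` LCC10_gens k"
  shows "(\<exists>S \<subseteq> {0..<n}. card S = 5 \<and> graph_diameter (circulant_graph n S) = ereal (of_int k))
       \<and> card G = 5 \<and> graph_diameter (circulant_graph n G) = ereal (of_int k)"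
proof -
  obtain m where k: "k = 5*m + 1"
    using assms(2) cong_iff_lin[of 1 k 5] by (auto simp: cong_sym_eq)
  then have m: "m \<ge> 0" using assms(1) by simp
  have n: "n = cc_order m" using assms(3) by (simp add: k LCC10_eq_cc_order)
  have n_pos: "n > 0" unfolding n cc_order_def using m by (intro add_nonneg_pos) simp_all
  have G: "G = (\<lambda>g. g mod n) ` {1, cc_gen2 m, cc_gen3 m, cc_gen4 m, cc_gen5 m}"
    using assms(4) by (simp add: k LCC10_gens_eq_cc_gens)
  have "card G = 5" unfolding G n using m by (rule card_cc_gens)
  moreover have "graph_diameter (circulant_graph n G) = ereal (of_int k)"
    unfolding G
  proof (rule circulant5_diameter_eqI[OF n_pos])
    show "k \<ge> 0" using assms(1) by simp
    show "\<exists>y1 y2 y3 y4 y5. l1 y1 y2 y3 y4 y5 \<le> k \<and>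
      [d = y1*1 + y2*cc_gen2 m + y3*cc_gen3 m + y4*cc_gen4 m + y5*cc_gen5 m] (mod n)" for d
      using ex_short_vector[OF m, of d] unfolding cc_value_def n k .
    show "k \<le> l1 y1 y2 y3 y4 y5"
      if "[cc_value m (m + 1) (m + 1) m m m =
        y1*1 + y2*cc_gen2 m + y3*cc_gen3 m + y4*cc_gen4 m + y5*cc_gen5 m] (mod n)"
      for y1 y2 y3 y4 y5
      using l1_ge_of_deep_hole_value[OF m, of y1 y2 y3 y4 y5] that
      unfolding n k cc_value_def[of m y1 y2 y3 y4 y5] by blast
  qed
  moreover have "G \<subseteq> {0..<n}" unfolding G using n_pos by auto
  ultimately show ?thesis by blast
qed

end
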